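(* Let $f:\mathbb{N}\to\mathbb{C}$ be an arbitrary arithmetic function, let $P(x)$ be a polynomial with integer coefficients, and let $n\in\mathbb{N}$. Then \[ \sum_{\substack{a=1\\ (a,n)=1}}^{n} f\big((P(a),n)\big)=\varphi(n)\sum_{d\mid n}\frac{(\mu*f)(d)}{\varphi(d)}\,N_P(d), \] where $N_P(d)$ is the number of incongruent solutions $x \pmod d$ of the congruence $P(x)\equiv 0\pmod d$ such that $(x,d)=1$.
   Context: $(x,y)$ denotes the greatest common divisor (with $(0,n)=n$). $\varphi$ is Euler's totient function, $\mu$ is the Möbius function and $(\mu*f)(m)=\sum_{k\mid m}\mu(k)f(m/k)$ is the Dirichlet convolution. *)

theory Defs
  imports
    Complex_Main
    "HOL-Computational_Algebra.Computational_Algebra"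
    "HOL-Number_Theory.Number_Theory"
begin

definition moebius_mu :: "nat \<Rightarrow> 'a :: comm_ring_1" where
  "moebius_mu n = (if squarefree n then (-1) ^ card (prime_factors n) else 0)"

definition dirichlet_conv ::
  "(nat \<Rightarrow> 'a :: comm_semiring_1) \<Rightarrow> (nat \<Rightarrow> 'a) \<Rightarrow> nat \<Rightarrow> 'a" where
  "dirichlet_conv f g m = (\<Sum>k | k dvd m. f k * g (m div k))"

(* The residue classes mod d are represented by 0, ..., d - 1; for d = 1 the only class is
   that of 0, which is coprime to 1. *)
definition num_unit_roots_mod :: "int poly \<Rightarrow> nat \<Rightarrow> nat" where
  "num_unit_roots_mod P d =
     card {x \<in> {0..<int d}. [poly P x = 0] (mod int d) \<and> gcd x (int d) = 1}"

end

theory Submission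
  imports Defs
begin

text \<open>
  Moebius inversion gives \<open>f m = (\<Sum>d | d dvd m. (\<mu> * f) d)\<close>. Inserting this for
  \<open>m = (P(a), n)\<close> and exchanging the sums, it remains to count the units \<open>a\<close> modulo \<open>n\<close> with
  \<open>d dvd P(a)\<close>. Units modulo \<open>d\<close> lift to units modulo \<open>n\<close>, so multiplication by units modulo \<open>n\<close>
  permutes the fibres of the reduction modulo \<open>d\<close> transitively; hence each of the \<open>N\<^sub>P(d)\<close> unit
  roots has \<open>\<phi>(n) / \<phi>(d)\<close> preimages.
\<close>

lemma prime_factorization_prod_primes:
  fixes A :: "'a :: factorial_semiring set"
  assumes "finite A" "\<And>p. p \<in> A \<Longrightarrow> prime p"
  shows "prime_factorization (\<Prod>A) = mset_set A"
  using assms by (intro prime_factorization_eqI_strong) (auto simp: prod_unfold_prod_mset)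

lemma prod_prime_factors_squarefree:
  fixes n :: "'a :: factorial_semiring_multiplicative"
  assumes "squarefree n"
  shows "\<Prod>(prime_factors n) = normalize n"
proof -
  have "n \<noteq> 0"
    using assms by auto
  then have "normalize n = (\<Prod>p\<in>prime_factors n. p ^ multiplicity p n)"
    by (simp add: prod_prime_factors)
  also have "\<dots> = \<Prod>(prime_factors n)"
    using assms \<open>n \<noteq> 0\<close> by (intro prod.cong) (auto simp: squarefree_factorial_semiring')
  finally show ?thesis ..
qed

lemma bij_betw_prime_factors_squarefree_divisors:
  fixes n :: nat
  assumes "n > 0"
  shows "bij_betw prime_factors {d. d dvd n \<and> squarefree d} (Pow (prime_factors n))"
proof (rule bij_betw_byWitness[where f' = "\<lambda>A. \<Prod>A"])
  have "prime_factors (\<Prod>A) = A \<and> \<Prod>A dvd n \<and> squarefree (\<Prod>A)" if "A \<subseteq> prime_factors n" for A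
  proof -
    have "finite A" and primes: "\<And>p. p \<in> A \<Longrightarrow> prime p"
      using that finite_subset by auto
    then have factorization: "prime_factorization (\<Prod>A) = mset_set A"
      by (rule prime_factorization_prod_primes)
    have "\<Prod>A \<noteq> 0"
      using that \<open>finite A\<close> by auto
    have "mset_set A \<subseteq># prime_factorization n"
      using that by (meson finite_set_mset mset_set_set_mset_msubset subset_imp_msubset_mset_set
          subset_mset.order_trans)
    then have "\<Prod>A dvd n"
      using assms \<open>\<Prod>A \<noteq> 0\<close> by (simp flip: factorization add: prime_factorization_subset_iff_dvd)
    moreover have "squarefree (\<Prod>A)"
      using primes by (intro squarefree_prod_coprime) (auto simp: primes_coprime squarefree_prime)
    ultimately show ?thesis
      using factorization \<open>finite A\<close> by simp
  qed
  then show "\<forall>A\<in>Pow (prime_factors n). prime_factors (\<Prod>A) = A"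
    and "(\<lambda>A. \<Prod>A) ` Pow (prime_factors n) \<subseteq> {d. d dvd n \<and> squarefree d}"
    by auto
qed (use assms dvd_prime_factors in \<open>auto simp: prod_prime_factors_squarefree\<close>)

lemma sum_moebius_mu_divisors:
  assumes "n > 0"
  shows "(\<Sum>d | d dvd n. moebius_mu d) = (if n = 1 then 1 else (0 :: 'a :: comm_ring_1))"
proof -
  have "(\<Sum>d | d dvd n. moebius_mu d) = 
        (\<Sum>d | d dvd n \<and> squarefree d. (-1) ^ card (prime_factors d) :: 'a)"
    using assms by (intro sum.mono_neutral_cong_right) (auto simp: moebius_mu_def)
  also have "\<dots> = (\<Sum>A\<in>Pow (prime_factors n). (-1) ^ card A)"
    by (rule sum.reindex_bij_betw[OF bij_betw_prime_factors_squarefree_divisors[OF assms]])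
  also have "\<dots> = (\<Prod>p\<in>prime_factors n. 1 - 1)"
    by (subst prod_diff_conv_sum) simp_all
  also have "\<dots> = (if n = 1 then 1 else 0)"
    using assms by (auto simp: power_0_left prime_factorization_empty_iff)
  finally show ?thesis .
qed

lemma sum_divisors_dirichlet_conv:
  fixes f g :: "nat \<Rightarrow> 'a :: comm_semiring_1"
  assumes "n > 0"
  shows "(\<Sum>d | d dvd n. dirichlet_conv f g d) = dirichlet_conv (\<lambda>d. \<Sum>k | k dvd d. f k) g n"
proof -
  have finite_divisors: "finite {d. d dvd k}" if "k dvd n" for k
    using assms that dvd_pos_nat finite_divisors_nat by blast
  have "(\<Sum>d | d dvd n. dirichlet_conv f g d) =
        (\<Sum>(d, k)\<in>Sigma {d. d dvd n} (\<lambda>d. {k. k dvd d}). f k * g (d div k))"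
    unfolding dirichlet_conv_def by (intro sum.Sigma ballI finite_divisors) auto
  also have "\<dots> = (\<Sum>(d, k)\<in>Sigma {d. d dvd n} (\<lambda>d. {k. k dvd d}). f k * g (n div d))"
    \<comment> \<open>With \<open>n = k * m * e\<close>, this exchanges \<open>(k * m, k)\<close> and \<open>(k * e, k)\<close>.\<close>
    using assms
    by (intro sum.reindex_bij_witness[where i = "\<lambda>(d, k). (n div (d div k), k)"
          and j = "\<lambda>(d, k). (n div (d div k), k)"])
       (auto elim!: dvdE)
  also have "\<dots> = (\<Sum>d | d dvd n. \<Sum>k | k dvd d. f k * g (n div d))"
    by (rule sum.Sigma [symmetric]) (use finite_divisors in auto)
  finally show ?thesis
    by (simp add: dirichlet_conv_def sum_distrib_right)
qed

lemma sum_divisors_dirichlet_conv_moebius_mu: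
  fixes f :: "nat \<Rightarrow> 'a :: comm_ring_1"
  assumes "n > 0"
  shows "(\<Sum>d | d dvd n. dirichlet_conv moebius_mu f d) = f n"
proof -
  have "(\<Sum>d | d dvd n. dirichlet_conv moebius_mu f d) =
        (\<Sum>d | d dvd n. (\<Sum>k | k dvd d. moebius_mu k) * f (n div d))"
    using sum_divisors_dirichlet_conv[OF assms] by (simp only: dirichlet_conv_def)
  also have "\<dots> = (\<Sum>d | d dvd n. if d = 1 then f n else 0)"
    using assms by (intro sum.cong) (auto simp: sum_moebius_mu_divisors dvd_pos_nat)
  also have "\<dots> = f n"
    using assms by simp
  finally show ?thesis .
qed

lemma sum_gcd_eq_sum_divisors:
  fixes f :: "nat \<Rightarrow> 'a :: comm_ring_1" and g :: "'b \<Rightarrow> int"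
  assumes "finite A" "n > 0"
  shows "(\<Sum>a\<in>A. f (nat (gcd (g a) (int n)))) =
         (\<Sum>d | d dvd n. dirichlet_conv moebius_mu f d * of_nat (card {a \<in> A. int d dvd g a}))"
proof -
  have "(\<Sum>a\<in>A. f (nat (gcd (g a) (int n)))) =
        (\<Sum>a\<in>A. \<Sum>d | d dvd n \<and> int d dvd g a. dirichlet_conv moebius_mu f d)"
  proof (rule sum.cong)
    fix a
    have "d dvd nat (gcd (g a) (int n)) \<longleftrightarrow> d dvd n \<and> int d dvd g a" for d
      by (auto simp: nat_dvd_iff simp flip: int_dvd_int_iff)
    then show "f (nat (gcd (g a) (int n))) =
          (\<Sum>d | d dvd n \<and> int d dvd g a. dirichlet_conv moebius_mu f d)"
      using sum_divisors_dirichlet_conv_moebius_mu[of "nat (gcd (g a) (int n))" f] assms(2) by simp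
  qed simp
  also have "\<dots> = (\<Sum>d | d dvd n. \<Sum>a | a \<in> A \<and> int d dvd g a. dirichlet_conv moebius_mu f d)"
    using assms sum.swap_restrict[of A "{d. d dvd n}" "\<lambda>_. dirichlet_conv moebius_mu f"
        "\<lambda>a d. int d dvd g a"] by simp
  finally show ?thesis
    by (simp add: mult.commute)
qed

text \<open>
  This differs from \<^const>\<open>totatives\<close> only for \<open>n = 1\<close>, where the representative is \<open>0\<close>, as in
  \<^const>\<open>num_unit_roots_mod\<close>.
\<close>

definition unit_residues :: "nat \<Rightarrow> nat set" where
  "unit_residues n = {a. a < n \<and> coprime a n}"

lemma finite_unit_residues [simp]: "finite (unit_residues n)"
  by (simp add: unit_residues_def)

lemma unit_residues_0 [simp]: "unit_residues 0 = {}"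
  by (simp add: unit_residues_def)

lemma unit_residues_Suc_0 [simp]: "unit_residues (Suc 0) = {0}"
  by (auto simp: unit_residues_def)

lemma totatives_eq_unit_residues:
  assumes "n > 1"
  shows "totatives n = unit_residues n"
  using assms by (auto simp: unit_residues_def in_totatives_iff totatives_less intro!: Nat.gr0I)

lemma card_unit_residues [simp]: "card (unit_residues n) = totient n"
proof -
  consider "n = 0" | "n = 1" | "n > 1"
    by linarith
  then show ?thesis
    by cases (auto simp: totient_def totatives_eq_unit_residues)
qed

lemma mod_in_unit_residues:
  assumes "d dvd n" "a \<in> unit_residues n"
  shows "a mod d \<in> unit_residues d"
proof -
  have "n > 0" "coprime a n"
    using assms(2) by (auto simp: unit_residues_def)
  have "d > 0"
    using \<open>n > 0\<close> assms(1) by (rule dvd_pos_nat)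
  moreover have "coprime a d"
    using coprime_divisors[OF dvd_refl assms(1) \<open>coprime a n\<close>] .
  ultimately show ?thesis
    by (simp add: unit_residues_def)
qed

lemma exists_coprime_add_mult:
  fixes x d n :: "'a :: factorial_semiring"
  assumes "n \<noteq> 0" "coprime x d"
  shows "\<exists>k. coprime (x + d * k) n"
proof -
  \<comment> \<open>Every prime divisor of \<open>n\<close> divides exactly one of \<open>x\<close> and \<open>d * k\<close>.\<close>
  define k where "k = \<Prod>{p \<in> prime_factors n. \<not> p dvd x}"
  have dvd_k_iff: "p dvd k \<longleftrightarrow> \<not> p dvd x" if "prime p" "p dvd n" for p
  proof -
    have "p dvd k \<longleftrightarrow> (\<exists>q\<in>{q \<in> prime_factors n. \<not> q dvd x}. p dvd q)"
      unfolding k_def using that by (subst prime_dvd_prod_iff) auto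
    also have "\<dots> \<longleftrightarrow> \<not> p dvd x"
      using that assms by (auto simp: in_prime_factors_iff dest: primes_dvd_imp_eq)
    finally show ?thesis .
  qed
  have no_common_prime: "\<not> p dvd x + d * k" if "prime p" "p dvd n" for p
  proof (cases "p dvd x")
    case True
    then have "\<not> p dvd d"
      using assms(2) that(1) by (meson coprime_common_divisor not_prime_unit)
    then show ?thesis
      using True that by (simp add: dvd_add_right_iff prime_dvd_mult_iff dvd_k_iff)
  next
    case False
    then show ?thesis
      using that by (simp add: dvd_add_left_iff dvd_k_iff)
  qed
  have "coprime (x + d * k) n"
  proof (rule coprimeI, rule ccontr)
    fix c
    assume common_divisor: "c dvd x + d * k" "c dvd n" "\<not> is_unit c"
    then have "c \<noteq> 0"
      using assms(1) by auto
    then obtain p where "p dvd c" "prime p"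
      using common_divisor(3) prime_divisor_exists by blast
    then show False
      using no_common_prime[of p] dvd_trans[OF \<open>p dvd c\<close>] common_divisor by blast
  qed
  then show ?thesis ..
qed

lemma exists_coprime_mult_cong:
  fixes x y d n :: nat
  assumes "n > 0" "coprime x d" "coprime y d"
  shows "\<exists>u. coprime u n \<and> [u * x = y] (mod d)"
proof -
  obtain v where inverse: "[x * v = 1] (mod d)"
    using assms cong_solve_coprime_nat by auto
  then have "coprime v d"
    by (metis cong_imp_coprime cong_sym coprime_1_left coprime_mult_left_iff)
  then obtain k where "coprime (v * y + d * k) n"
    using exists_coprime_add_mult[of n "v * y" d] assms by auto
  moreover have "[(v * y + d * k) * x = y] (mod d)"
  proof -
    have "[(v * y + d * k) * x = v * y * x] (mod d)"
      by (intro cong_scalar_right) (simp add: cong_def)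
    also have "v * y * x = x * v * y"
      by (simp add: mult_ac)
    also have "[x * v * y = 1 * y] (mod d)"
      using inverse by (rule cong_scalar_right)
    finally show ?thesis
      by simp
  qed
  ultimately show ?thesis
    by blast
qed

lemma inj_on_mult_mod_unit_residues:
  assumes "coprime u n"
  shows "inj_on (\<lambda>a. u * a mod n) (unit_residues n)"
proof (rule inj_onI)
  fix a b
  assume residues: "a \<in> unit_residues n" "b \<in> unit_residues n" and "u * a mod n = u * b mod n"
  then have "[a = b] (mod n)"
    using assms by (simp add: cong_mult_lcancel_nat flip: cong_def)
  then show "a = b"
    using residues by (simp add: unit_residues_def cong_def)
qed

lemma card_unit_residues_mod_eq_le:
  assumes "d dvd n" "x \<in> unit_residues d" "y \<in> unit_residues d"
  shows "card {a \<in> unit_residues n. a mod d = x} \<le> card {a \<in> unit_residues n. a mod d = y}"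
proof (cases "n = 0")
  case False
  obtain u where u_coprime: "coprime u n" and u_maps: "[u * x = y] (mod d)"
    using exists_coprime_mult_cong[of n x d y] assms False by (auto simp: unit_residues_def)
  show ?thesis
  proof (rule card_inj_on_le)
    show "inj_on (\<lambda>a. u * a mod n) {a \<in> unit_residues n. a mod d = x}"
      using inj_on_mult_mod_unit_residues[OF u_coprime] by (rule inj_on_subset) auto
    have "u * a mod n mod d = y" if "a mod d = x" for a
      using that u_maps assms
      by (auto simp: mod_mod_cancel mod_mult_right_eq cong_def unit_residues_def)
    then show "(\<lambda>a. u * a mod n) ` {a \<in> unit_residues n. a mod d = x} \<subseteq>
          {a \<in> unit_residues n. a mod d = y}"
      using u_coprime False by (auto simp: unit_residues_def)
  qed simp
qed simp

lemma sum_unit_residues_mod: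
  fixes h :: "nat \<Rightarrow> 'a :: comm_semiring_1"
  assumes "d dvd n"
  shows "of_nat (totient d) * (\<Sum>a\<in>unit_residues n. h (a mod d)) =
         of_nat (totient n) * (\<Sum>x\<in>unit_residues d. h x)"
proof -
  define fibre where "fibre x = {a \<in> unit_residues n. a mod d = x}" for x
  have reduction: "(\<lambda>a. a mod d) ` unit_residues n \<subseteq> unit_residues d"
    using assms mod_in_unit_residues by auto
  obtain c where card_fibre: "card (fibre x) = c" if "x \<in> unit_residues d" for x
    using card_unit_residues_mod_eq_le[OF assms] unfolding fibre_def by (meson antisym)
  have "totient n = (\<Sum>x\<in>unit_residues d. card (fibre x))"
    using sum.group[OF _ _ reduction, of "\<lambda>_. 1::nat"] by (simp add: fibre_def)
  then have totient: "totient n = totient d * c"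
    using card_fibre by simp
  have "(\<Sum>a\<in>unit_residues n. h (a mod d)) =
        (\<Sum>x\<in>unit_residues d. \<Sum>a\<in>fibre x. h (a mod d))"
    unfolding fibre_def by (rule sum.group[symmetric]) (use reduction in auto)
  also have "\<dots> = (\<Sum>x\<in>unit_residues d. of_nat c * h x)"
    by (intro sum.cong) (auto simp: fibre_def simp flip: card_fibre)
  finally show ?thesis
    by (simp add: totient sum_distrib_left mult_ac)
qed

lemma cong_poly:
  fixes P :: "'a :: unique_euclidean_semiring poly"
  assumes "[x = y] (mod m)"
  shows "[poly P x = poly P y] (mod m)"
  using assms by (induction P) (auto intro!: cong_add cong_mult)

lemma num_unit_roots_mod_eq_card:
  "num_unit_roots_mod P d = card {x \<in> unit_residues d. int d dvd poly P (int x)}"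
  unfolding num_unit_roots_mod_def
  by (rule bij_betw_same_card[of nat], rule bij_betw_byWitness[where f' = int])
     (auto simp: unit_residues_def cong_0_iff nat_less_iff simp flip: coprime_iff_gcd_eq_1
        coprime_int_iff)

lemma card_unit_residues_dvd_poly:
  assumes "d dvd n"
  shows "totient d * card {a \<in> unit_residues n. int d dvd poly P (int a)} =
         totient n * num_unit_roots_mod P d"
proof -
  have "int d dvd poly P (int (a mod d)) \<longleftrightarrow> int d dvd poly P (int a)" for a
    by (intro cong_dvd_iff cong_poly) (simp add: zmod_int)
  then show ?thesis
    using sum_unit_residues_mod[OF assms, of "\<lambda>x. of_bool (int d dvd poly P (int x)) :: nat"]
    by (simp add: num_unit_roots_mod_eq_card Int_def)
qed

corollary of_nat_card_unit_residues_dvd_poly: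
  assumes "n > 0" "d dvd n"
  shows "of_nat (card {a \<in> unit_residues n. int d dvd poly P (int a)}) =
    (of_nat (totient n) / of_nat (totient d) * of_nat (num_unit_roots_mod P d) :: 'a :: field_char_0)"
proof -
  have "totient d \<noteq> 0"
    using assms by (auto simp: dvd_pos_nat)
  then show ?thesis
    using card_unit_residues_dvd_poly[OF assms(2), of P]
    by (simp add: field_simps flip: of_nat_mult)
qed

theorem theorem7:
  fixes f :: "nat \<Rightarrow> complex" and P :: "int poly" and n :: nat
  assumes "n \<ge> 1"
  shows "(\<Sum>a | a \<in> {1..n} \<and> gcd a n = 1. f (nat (gcd (poly P (int a)) (int n)))) =
         of_nat (totient n) *
           (\<Sum>d | d dvd n. dirichlet_conv moebius_mu f d / of_nat (totient d)
                            * of_nat (num_unit_roots_mod P d))"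
proof -
  have "{a. a \<in> {1..n} \<and> gcd a n = 1} = totatives n"
    unfolding totatives_def coprime_iff_gcd_eq_1 by auto
  then have "(\<Sum>a | a \<in> {1..n} \<and> gcd a n = 1. f (nat (gcd (poly P (int a)) (int n)))) =
        (\<Sum>a\<in>unit_residues n. f (nat (gcd (poly P (int a)) (int n))))"
    using assms by (cases "n = 1") (simp_all add: totatives_eq_unit_residues)
  also have "\<dots> = (\<Sum>d | d dvd n. dirichlet_conv moebius_mu f d *
                     of_nat (card {a \<in> unit_residues n. int d dvd poly P (int a)}))"
    using assms by (intro sum_gcd_eq_sum_divisors) auto
  also have "\<dots> = (\<Sum>d | d dvd n. of_nat (totient n) * (dirichlet_conv moebius_mu f d /
                     of_nat (totient d) * of_nat (num_unit_roots_mod P d)))"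
    using assms by (intro sum.cong) (simp_all add: of_nat_card_unit_residues_dvd_poly)
  finally show ?thesis
    by (simp add: sum_distrib_left)
qed

end
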